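(* Let $\mathcal H$ be an infinite-dimensional complex Hilbert space, let $\mathbf A=(A_1,\dots,A_m)\in\mathcal S(\mathcal H)^m$, let $n\ge1$ be an integer and let $\mathbf F_0\in\mathcal S(\mathcal H)^m\cap\mathcal F(\mathcal H)^m$. Then the following sets are equal: (a) $\Lambda_\infty(\mathbf A)$; (b) $\Lambda_\infty(\mathbf A+\mathbf F_0)$; (c) $\bigcap\{\Lambda_n(\mathbf A+\mathbf F):\ \mathbf F\in\mathcal F(\mathcal H)^m\cap\mathcal S(\mathcal H)^m\}$; (d) $\bigcap_{k\ge1}\big(\bigcap\{\Lambda_k(\mathbf A+\mathbf F):\ \mathbf F\in\mathcal F(\mathcal H)^m\cap\mathcal S(\mathcal H)^m\}\big)$.
   Context: $\mathcal S(\mathcal H)$ is the set of bounded self-adjoint operators on $\mathcal H$ and $\mathcal F(\mathcal H)$ the set of finite-rank operators; for $\mathbf F=(F_1,\dots,F_m)$, $\mathbf A+\mathbf F=(A_1+F_1,\dots,A_m+F_m)$. For a positive integer $k$, $\Lambda_k(\mathbf A)=\{(a_1,\dots,a_m)\in\mathbb R^m:$ there is an orthogonal projection $P$ of rank $k$ on $\mathcal H$ with $PA_jP=a_jP$ for all $j\}$; $\Lambda_\infty(\mathbf A)$ is defined the same way with $P$ of infinite rank. *)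

theory Defs
  imports Complex_Main
begin

class complex_vector = ab_group_add +
  fixes scaleC :: "complex \<Rightarrow> 'a \<Rightarrow> 'a"
  assumes scaleC_add_right: "scaleC a (x + y) = scaleC a x + scaleC a y"
    and scaleC_add_left: "scaleC (a + b) x = scaleC a x + scaleC b x"
    and scaleC_scaleC: "scaleC a (scaleC b x) = scaleC (a * b) x"
    and scaleC_one: "scaleC 1 x = x"

class complex_inner = complex_vector +
  fixes cinner :: "'a \<Rightarrow> 'a \<Rightarrow> complex"
  assumes cinner_commute: "cinner x y = cnj (cinner y x)"
    and cinner_add_right: "cinner x (y + z) = cinner x y + cinner x z"
    and cinner_scaleC_right: "cinner x (scaleC a y) = a * cinner x y"
    and cinner_ge_zero: "0 \<le> Re (cinner x x)"
    and cinner_eq_zero_iff: "cinner x x = 0 \<longleftrightarrow> x = 0"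

definition cnorm :: "'a::complex_inner \<Rightarrow> real" where
  "cnorm x = sqrt (Re (cinner x x))"

class chilbert_space = complex_inner +
  assumes cauchy_convergent:
    "(\<forall>e>0. \<exists>N. \<forall>m\<ge>N. \<forall>n\<ge>N.
        sqrt (Re (cinner (X m - X n) (X m - X n))) < e)
     \<Longrightarrow> \<exists>L. (\<lambda>n. sqrt (Re (cinner (X n - L) (X n - L)))) \<longlonglongrightarrow> 0"

definition cspan :: "'a::complex_vector set \<Rightarrow> 'a set" where
  "cspan S = {(\<Sum>v\<in>T. scaleC (c v) v) | T c. finite T \<and> T \<subseteq> S}"

definition cindependent :: "'a::complex_vector set \<Rightarrow> bool" where
  "cindependent S \<longleftrightarrow> (\<forall>T c. finite T \<and> T \<subseteq> S \<and> (\<Sum>v\<in>T. scaleC (c v) v) = 0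
      \<longrightarrow> (\<forall>v\<in>T. c v = 0))"

definition infinite_dimensional :: "'a::complex_vector itself \<Rightarrow> bool" where
  "infinite_dimensional TYPE('a) \<longleftrightarrow> \<not> (\<exists>S::'a set. finite S \<and> cspan S = UNIV)"

definition bounded_op :: "('a::complex_inner \<Rightarrow> 'a) \<Rightarrow> bool" where
  "bounded_op A \<longleftrightarrow> (\<forall>x y. A (x + y) = A x + A y) \<and> (\<forall>a x. A (scaleC a x) = scaleC a (A x))
     \<and> (\<exists>K. \<forall>x. cnorm (A x) \<le> K * cnorm x)"

definition self_adjoint :: "('a::complex_inner \<Rightarrow> 'a) \<Rightarrow> bool" where
  "self_adjoint A \<longleftrightarrow> bounded_op A \<and> (\<forall>x y. cinner (A x) y = cinner x (A y))"

definition finite_rank :: "('a::complex_inner \<Rightarrow> 'a) \<Rightarrow> bool" where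
  "finite_rank F \<longleftrightarrow> bounded_op F \<and> (\<exists>S. finite S \<and> range F \<subseteq> cspan S)"

definition orth_proj :: "('a::complex_inner \<Rightarrow> 'a) \<Rightarrow> bool" where
  "orth_proj P \<longleftrightarrow> self_adjoint P \<and> (\<forall>x. P (P x) = P x)"

definition has_rank :: "('a::complex_inner \<Rightarrow> 'a) \<Rightarrow> nat \<Rightarrow> bool" where
  "has_rank P k \<longleftrightarrow> (\<exists>B. finite B \<and> card B = k \<and> cindependent B \<and> cspan B = range P)"

definition infinite_rank :: "('a::complex_inner \<Rightarrow> 'a) \<Rightarrow> bool" where
  "infinite_rank P \<longleftrightarrow> \<not> (\<exists>S. finite S \<and> range P \<subseteq> cspan S)"

definition compresses :: "('a::complex_inner \<Rightarrow> 'a) \<Rightarrow> ('a \<Rightarrow> 'a) list \<Rightarrow> real list \<Rightarrow> bool" where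
  "compresses P A a \<longleftrightarrow> length a = length A \<and>
     (\<forall>j<length A. \<forall>x. P ((A ! j) (P x)) = scaleC (complex_of_real (a ! j)) (P x))"

definition rank_k_numrange :: "nat \<Rightarrow> ('a::complex_inner \<Rightarrow> 'a) list \<Rightarrow> real list set" where
  "rank_k_numrange k A = {a. length a = length A \<and>
       (\<exists>P. orth_proj P \<and> has_rank P k \<and> compresses P A a)}"

definition infty_numrange :: "('a::complex_inner \<Rightarrow> 'a) list \<Rightarrow> real list set" where
  "infty_numrange A = {a. length a = length A \<and>
       (\<exists>P. orth_proj P \<and> infinite_rank P \<and> compresses P A a)}"

definition op_tuple_add :: "('a::complex_inner \<Rightarrow> 'a) list \<Rightarrow> ('a \<Rightarrow> 'a) list \<Rightarrow> ('a \<Rightarrow> 'a) list" where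
  "op_tuple_add A F = map2 (\<lambda>X Y x. X x + Y x) A F"

definition sa_finite_rank_tuples :: "nat \<Rightarrow> ('a::complex_inner \<Rightarrow> 'a) list set" where
  "sa_finite_rank_tuples m = {F. length F = m \<and> (\<forall>j<m. self_adjoint (F ! j) \<and> finite_rank (F ! j))}"

end

theory Submission
  imports Defs
begin

text \<open>A point \<open>a\<close> lies in \<open>\<Lambda>\<^sub>\<infinity>(A)\<close> iff there is an orthonormal sequence \<open>e\<close> with
  \<open>\<langle>e\<^sub>i, A\<^sub>j e\<^sub>k\<rangle> = a\<^sub>j \<delta>\<^sub>i\<^sub>k\<close>. Since a finite rank operator vanishes on a subspace of finite
  codimension, the sequence can be chosen in the kernel of any finite rank tuple, so \<open>\<Lambda>\<^sub>\<infinity>(A)\<close> is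
  contained in all the other sets.

  Conversely, it suffices to find, orthogonally to any given finite set \<open>S\<close>, a unit vector \<open>x\<close>
  with \<open>\<langle>x, A\<^sub>j x\<rangle> = a\<^sub>j\<close>; the sequence is then built recursively, each vector orthogonal to its
  predecessors and to their images under the \<open>A\<^sub>j\<close>. The compression of \<open>A\<close> to the complement of
  \<open>S\<close> has scalar compressions \<open>c\<close> of every finite rank, so its joint numerical range is
  star-shaped about \<open>c\<close>. Perturbing \<open>A\<close> to act on the span of \<open>S\<close> as the scalars \<open>c\<^sub>j\<close> displays
  \<open>a\<close> as a point of a segment from \<open>c\<close> to that numerical range.\<close>

text \<open>Makes the general theory of spans, dependence and subspaces available for the class
  \<open>complex_vector\<close>; the two lemmas that follow carry \<open>cspan\<close> and
  \<open>cindependent\<close> over to it.\<close>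

interpretation cvs: vector_space "scaleC :: complex \<Rightarrow> 'a::complex_vector \<Rightarrow> 'a"
  by unfold_locales (simp_all add: scaleC_add_right scaleC_add_left scaleC_scaleC scaleC_one)

lemma cspan_eq_span: "cspan S = cvs.span S"
  unfolding cspan_def cvs.span_explicit by blast

lemma cindependent_iff: "cindependent S \<longleftrightarrow> cvs.independent S"
  unfolding cindependent_def cvs.dependent_explicit by blast

section \<open>Inner products and the norm\<close>

lemma cinner_add_left: "cinner (x + y) z = cinner x z + cinner y z"
  by (metis cinner_commute cinner_add_right complex_cnj_add)

lemma cinner_scaleC_left: "cinner (scaleC a x) y = cnj a * cinner x y"
  by (metis cinner_commute cinner_scaleC_right complex_cnj_mult)

lemma cinner_zero_right [simp]: "cinner x 0 = 0"
  using cinner_add_right[of x 0 0] by simp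

lemma cinner_zero_left [simp]: "cinner 0 x = 0"
  using cinner_add_left[of 0 0 x] by simp

lemma cinner_minus_right: "cinner x (- y) = - cinner x y"
  using cinner_add_right[of x y "- y"] by (simp add: eq_neg_iff_add_eq_0 add.commute)

lemma cinner_minus_left: "cinner (- x) y = - cinner x y"
  by (metis cinner_commute cinner_minus_right complex_cnj_minus)

lemma cinner_diff_right: "cinner x (y - z) = cinner x y - cinner x z"
  using cinner_add_right[of x y "- z"] by (simp add: cinner_minus_right)

lemma cinner_diff_left: "cinner (x - y) z = cinner x z - cinner y z"
  using cinner_add_left[of x "- y" z] by (simp add: cinner_minus_left)

lemma cinner_sum_right: "cinner x (\<Sum>i\<in>I. f i) = (\<Sum>i\<in>I. cinner x (f i))"
  by (induction I rule: infinite_finite_induct) (simp_all add: cinner_add_right)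

lemma cinner_sum_left: "cinner (\<Sum>i\<in>I. f i) x = (\<Sum>i\<in>I. cinner (f i) x)"
  by (induction I rule: infinite_finite_induct) (simp_all add: cinner_add_left)

lemmas cinner_simps = cinner_add_left cinner_add_right cinner_diff_left cinner_diff_right
  cinner_minus_left cinner_minus_right cinner_scaleC_left cinner_scaleC_right

lemma cinner_extensionality: "(\<And>y. cinner y x = cinner y z) \<Longrightarrow> x = z"
  using cinner_eq_zero_iff[of "x - z"] by (simp add: cinner_diff_right)

lemma cinner_eq_zero_commute: "cinner x y = 0 \<longleftrightarrow> cinner y x = 0"
  by (metis cinner_commute complex_cnj_zero)

lemma cinner_self_real: "cinner x x = complex_of_real (Re (cinner x x))"
  using cinner_commute[of x x] by (simp add: complex_eq_iff)

lemma cnorm_ge_zero [simp]: "0 \<le> cnorm x"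
  by (simp add: cnorm_def cinner_ge_zero)

lemma cnorm_square: "(cnorm x)\<^sup>2 = Re (cinner x x)"
  by (simp add: cnorm_def cinner_ge_zero)

lemma cinner_self: "cinner x x = complex_of_real ((cnorm x)\<^sup>2)"
  using cinner_self_real by (simp add: cnorm_square)

lemma cnorm_eq_zero [simp]: "cnorm x = 0 \<longleftrightarrow> x = 0"
  using cinner_eq_zero_iff[of x] by (simp add: cinner_self)

lemma cnorm_zero [simp]: "cnorm 0 = 0"
  by simp

lemma cnorm_scaleC: "cnorm (scaleC a x) = cmod a * cnorm x"
proof -
  have "cinner (scaleC a x) (scaleC a x) = (a * cnj a) * cinner x x"
    by (simp add: cinner_simps mult_ac)
  also have "\<dots> = complex_of_real ((cmod a * cnorm x)\<^sup>2)"
    unfolding complex_norm_square[symmetric] cinner_self by (simp add: power_mult_distrib)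
  finally have "cinner (scaleC a x) (scaleC a x) = complex_of_real ((cmod a * cnorm x)\<^sup>2)" .
  then have "(cnorm (scaleC a x))\<^sup>2 = (cmod a * cnorm x)\<^sup>2"
    by (simp add: cnorm_square del: of_real_power)
  then show ?thesis by (rule power2_eq_imp_eq) simp_all
qed

lemma cinner_normalized:
  assumes "x \<noteq> 0"
  shows "cinner (scaleC (complex_of_real (1 / cnorm x)) x) (scaleC (complex_of_real (1 / cnorm x)) x) = 1"
  using assms by (simp add: cinner_self cnorm_scaleC norm_divide)

text \<open>Split \<open>y\<close> into \<open>scaleC c x\<close> and a remainder \<open>z\<close>
  orthogonal to \<open>x\<close>; Pythagoras then bounds the norm of the first part by that of
  \<open>y\<close>.\<close>

lemma Cauchy_Schwarz_cinner: "cmod (cinner x y) \<le> cnorm x * cnorm y"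
proof (cases "x = 0")
  case False
  define c where "c = cinner x y / cinner x x"
  define z where "z = y - scaleC c x"
  have xx: "cinner x x \<noteq> 0" using False by (simp add: cinner_eq_zero_iff)
  have "cinner x z = 0" using xx by (simp add: z_def c_def cinner_simps)
  then have "cinner z x = 0" by (simp add: cinner_eq_zero_commute)
  have "y = z + scaleC c x" by (simp add: z_def)
  then have "cinner y y = cinner z z + cinner (scaleC c x) (scaleC c x)"
    using \<open>cinner x z = 0\<close> \<open>cinner z x = 0\<close> by (simp add: cinner_simps)
  then have "(cnorm y)\<^sup>2 = (cnorm z)\<^sup>2 + (cnorm (scaleC c x))\<^sup>2"
    by (simp only: cnorm_square plus_complex.sel)
  then have "(cnorm y)\<^sup>2 = (cnorm z)\<^sup>2 + (cmod c * cnorm x)\<^sup>2"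
    by (simp only: cnorm_scaleC)
  then have "(cmod c * cnorm x)\<^sup>2 \<le> (cnorm y)\<^sup>2" by simp
  then have "cmod c * cnorm x \<le> cnorm y" by (rule power2_le_imp_le) simp
  moreover have "cmod c = cmod (cinner x y) / (cnorm x)\<^sup>2"
    by (simp add: c_def norm_divide cinner_self norm_power)
  moreover have "0 < cnorm x" using False cnorm_ge_zero[of x] by (simp add: order_less_le)
  ultimately show ?thesis using \<open>cmod c * cnorm x \<le> cnorm y\<close>
    by (simp add: pos_divide_le_eq power2_eq_square mult_ac del: cnorm_eq_zero)
qed simp

lemma cnorm_triangle: "cnorm (x + y) \<le> cnorm x + cnorm y"
proof (rule power2_le_imp_le)
  have "Re (cinner x y) \<le> cnorm x * cnorm y" "Re (cinner y x) \<le> cnorm x * cnorm y"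
    using Cauchy_Schwarz_cinner[of x y] Cauchy_Schwarz_cinner[of y x]
      complex_Re_le_cmod[of "cinner x y"] complex_Re_le_cmod[of "cinner y x"]
    by (simp_all add: mult.commute)
  then show "(cnorm (x + y))\<^sup>2 \<le> (cnorm x + cnorm y)\<^sup>2"
    by (simp add: cnorm_square cinner_simps power2_sum)
qed simp

section \<open>Operators\<close>

lemma
  assumes "bounded_op A"
  shows bounded_op_add: "A (x + y) = A x + A y"
    and bounded_op_scaleC: "A (scaleC a x) = scaleC a (A x)"
  using assms by (simp_all add: bounded_op_def)

lemma bounded_op_zero: "bounded_op A \<Longrightarrow> A 0 = 0"
  using bounded_op_add[of A 0 0] by simp

lemma bounded_op_minus: "bounded_op A \<Longrightarrow> A (- x) = - A x"
  using bounded_op_scaleC[of A "- 1" x] by simp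

lemma bounded_op_diff: "bounded_op A \<Longrightarrow> A (x - y) = A x - A y"
  using bounded_op_add[of A x "- y"] by (simp add: bounded_op_minus)

lemma bounded_op_sum: "bounded_op A \<Longrightarrow> A (\<Sum>i\<in>I. f i) = (\<Sum>i\<in>I. A (f i))"
  by (induction I rule: infinite_finite_induct) (simp_all add: bounded_op_add bounded_op_zero)

lemmas bounded_op_simps = bounded_op_add bounded_op_scaleC bounded_op_zero bounded_op_minus
  bounded_op_diff

lemma bounded_op_nonneg_bound:
  assumes "bounded_op A"
  obtains K where "0 \<le> K" "\<And>x. cnorm (A x) \<le> K * cnorm x"
proof -
  obtain K where K: "cnorm (A x) \<le> K * cnorm x" for x
    using assms by (auto simp: bounded_op_def)
  have "cnorm (A x) \<le> \<bar>K\<bar> * cnorm x" for x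
    by (rule order_trans[OF K mult_right_mono]) simp_all
  then show thesis using that[of "\<bar>K\<bar>"] by simp
qed

lemma bounded_op_plus:
  assumes "bounded_op A" "bounded_op B"
  shows "bounded_op (\<lambda>x. A x + B x)"
proof -
  obtain K where K: "cnorm (A x) \<le> K * cnorm x" for x
    using assms(1) by (auto simp: bounded_op_def)
  obtain L where L: "cnorm (B x) \<le> L * cnorm x" for x
    using assms(2) by (auto simp: bounded_op_def)
  have "cnorm (A x + B x) \<le> (K + L) * cnorm x" for x
    using cnorm_triangle[of "A x" "B x"] K[of x] L[of x] by (simp add: distrib_right)
  then have "\<exists>K. \<forall>x. cnorm (A x + B x) \<le> K * cnorm x" by blast
  then show ?thesis
    using assms by (simp add: bounded_op_add bounded_op_scaleC scaleC_add_right ac_simps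
        bounded_op_def[of "\<lambda>x. A x + B x"])
qed

lemma bounded_op_compose:
  assumes "bounded_op A" "bounded_op B"
  shows "bounded_op (\<lambda>x. A (B x))"
proof -
  obtain K where K: "0 \<le> K" "cnorm (A x) \<le> K * cnorm x" for x
    using assms(1) by (rule bounded_op_nonneg_bound) blast
  obtain L where L: "cnorm (B x) \<le> L * cnorm x" for x
    using assms(2) by (auto simp: bounded_op_def)
  have "cnorm (A (B x)) \<le> (K * L) * cnorm x" for x
    using order_trans[OF K(2)[of "B x"] mult_left_mono[OF L K(1)]] by (simp add: mult.assoc)
  then show ?thesis
    using assms by (auto simp: bounded_op_def)
qed

lemma bounded_op_scale: "bounded_op (scaleC a)"
  by (auto simp: bounded_op_def scaleC_add_right scaleC_scaleC cnorm_scaleC mult.commute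
      intro!: exI[of _ "cmod a"])

lemma self_adjoint_bounded: "self_adjoint A \<Longrightarrow> bounded_op A"
  by (simp add: self_adjoint_def)

lemma self_adjointD: "self_adjoint A \<Longrightarrow> cinner (A x) y = cinner x (A y)"
  by (simp add: self_adjoint_def)

lemma self_adjoint_plus:
  "self_adjoint A \<Longrightarrow> self_adjoint B \<Longrightarrow> self_adjoint (\<lambda>x. A x + B x)"
  by (simp add: self_adjoint_def bounded_op_plus cinner_simps)

lemma self_adjoint_scale:
  "self_adjoint A \<Longrightarrow> self_adjoint (\<lambda>x. scaleC (complex_of_real r) (A x))"
  by (simp add: self_adjoint_def cinner_simps bounded_op_compose bounded_op_scale)

lemma self_adjoint_minus: "self_adjoint A \<Longrightarrow> self_adjoint (\<lambda>x. - A x)"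
  using self_adjoint_scale[of A "- 1"] by simp

lemma self_adjoint_id: "self_adjoint (\<lambda>x. x)"
  by (auto simp: self_adjoint_def bounded_op_def intro!: exI[of _ 1])

lemma self_adjoint_sandwich:
  "self_adjoint A \<Longrightarrow> self_adjoint B \<Longrightarrow> self_adjoint (\<lambda>x. B (A (B x)))"
  using bounded_op_compose[of B "\<lambda>x. A (B x)"] by (simp add: self_adjoint_def bounded_op_compose)

lemma self_adjoint_form_real:
  assumes "self_adjoint A"
  shows "cinner x (A x) = complex_of_real (Re (cinner x (A x)))"
proof -
  have "cnj (cinner x (A x)) = cinner x (A x)"
    using assms by (metis cinner_commute self_adjointD)
  then show ?thesis by (simp add: complex_eq_iff)
qed

text \<open>The kernel of a self-adjoint operator is the orthogonal complement of its range. A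
  finite rank perturbation is therefore invisible to vectors orthogonal to finitely many given
  ones.\<close>

lemma self_adjoint_eq_zero:
  assumes "self_adjoint F" "range F \<subseteq> cspan S" "\<And>s. s \<in> S \<Longrightarrow> cinner s x = 0"
  shows "F x = 0"
proof -
  have "cinner s x = 0" if "s \<in> cvs.span S" for s
    using that by (induction rule: cvs.span_induct_alt) (simp_all add: assms cinner_simps)
  then have "cinner (F y) x = 0" for y
    using assms(2) by (auto simp: cspan_eq_span)
  then show ?thesis
    using assms(1) by (intro cinner_extensionality) (simp add: self_adjointD)
qed

text \<open>Boundedness comes for free: the square of the norm of \<open>P x\<close> equals
  \<open>cinner x (P x)\<close>, and Cauchy-Schwarz gives the bound 1.\<close>

lemma orth_projI:
  assumes add: "\<And>x y. P (x + y) = P x + P y" and scale: "\<And>a x. P (scaleC a x) = scaleC a (P x)"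
    and adj: "\<And>x y. cinner (P x) y = cinner x (P y)" and idem: "\<And>x. P (P x) = P x"
  shows "orth_proj P"
proof -
  have "cnorm (P x) \<le> 1 * cnorm x" for x
  proof (cases "P x = 0")
    case False
    have "cinner (P x) (P x) = cinner x (P x)" by (simp add: adj idem)
    then have "cmod (complex_of_real ((cnorm (P x))\<^sup>2)) \<le> cnorm x * cnorm (P x)"
      using Cauchy_Schwarz_cinner[of x "P x"] by (simp add: cinner_self del: of_real_power)
    then have "cnorm (P x) * cnorm (P x) \<le> cnorm x * cnorm (P x)"
      by (simp add: power2_eq_square norm_mult)
    moreover have "0 < cnorm (P x)" using False cnorm_ge_zero[of "P x"] by (simp add: order_less_le)
    ultimately show ?thesis by simp
  qed simp
  then show ?thesis
    unfolding orth_proj_def self_adjoint_def bounded_op_def using assms by blast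
qed

section \<open>Orthonormal families\<close>

definition orthonormal_on :: "'i set \<Rightarrow> ('i \<Rightarrow> 'a::complex_inner) \<Rightarrow> bool" where
  "orthonormal_on I e \<longleftrightarrow> (\<forall>i\<in>I. \<forall>k\<in>I. cinner (e i) (e k) = of_bool (i = k))"

text \<open>For an orthonormal family and finite \<open>I\<close> this is the orthogonal projection
  onto the span. For infinite \<open>I\<close> the sum is 0 by convention, so sequences are treated
  separately by \<open>proj_seq\<close>.\<close>

definition proj_on :: "'i set \<Rightarrow> ('i \<Rightarrow> 'a::complex_inner) \<Rightarrow> 'a \<Rightarrow> 'a" where
  "proj_on I e x = (\<Sum>i\<in>I. scaleC (cinner (e i) x) (e i))"

text \<open>The matrix form of \<open>compresses\<close>: on the span of the family each operator
  compresses to a scalar. In this form the property can be checked on pairs of vectors and passes to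
  subfamilies.\<close>

definition scalar_on :: "'i set \<Rightarrow> ('i \<Rightarrow> 'a::complex_inner) \<Rightarrow> ('a \<Rightarrow> 'a) list \<Rightarrow> real list \<Rightarrow> bool" where
  "scalar_on I e A a \<longleftrightarrow> (\<forall>j<length A. \<forall>i\<in>I. \<forall>k\<in>I.
     cinner (e i) ((A ! j) (e k)) = complex_of_real (a ! j) * of_bool (i = k))"

lemma scalar_onD:
  "scalar_on I e A a \<Longrightarrow> j < length A \<Longrightarrow> i \<in> I \<Longrightarrow> k \<in> I \<Longrightarrow>
    cinner (e i) ((A ! j) (e k)) = complex_of_real (a ! j) * of_bool (i = k)"
  by (simp add: scalar_on_def)

lemma orthonormal_onD:
  "orthonormal_on I e \<Longrightarrow> i \<in> I \<Longrightarrow> k \<in> I \<Longrightarrow> cinner (e i) (e k) = of_bool (i = k)"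
  by (simp add: orthonormal_on_def)

lemma orthonormal_on_subset: "orthonormal_on I e \<Longrightarrow> J \<subseteq> I \<Longrightarrow> orthonormal_on J e"
  unfolding orthonormal_on_def by blast

lemma orthonormal_on_inj_on:
  assumes "orthonormal_on I e"
  shows "inj_on e I"
proof (rule inj_onI)
  fix i k assume ik: "i \<in> I" "k \<in> I" "e i = e k"
  then have "of_bool (i = k) = (1 :: complex)"
    using orthonormal_onD[OF assms, of i k] orthonormal_onD[OF assms, of i i] by simp
  then show "i = k" by (simp split: if_splits add: of_bool_def)
qed

lemma orthonormal_on_independent:
  assumes "orthonormal_on I e"
  shows "cvs.independent (e ` I)"
proof -
  have orth: "cinner v w = of_bool (v = w)" if "v \<in> e ` I" "w \<in> e ` I" for v w
    using that assms by (auto simp: orthonormal_onD)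
  have "u v = 0" if "finite T" "T \<subseteq> e ` I" "(\<Sum>w\<in>T. scaleC (u w) w) = 0" "v \<in> T" for T u v
  proof -
    have "0 = cinner v (\<Sum>w\<in>T. scaleC (u w) w)" using that by simp
    also have "\<dots> = (\<Sum>w\<in>T. u w * of_bool (v = w))"
      unfolding cinner_sum_right cinner_scaleC_right
      using that by (intro sum.cong refl arg_cong2[of _ _ _ _ "(*)"] orth) auto
    also have "\<dots> = u v" using that by (simp add: of_bool_def if_distrib cong: if_cong)
    finally show ?thesis by simp
  qed
  then show ?thesis unfolding cvs.dependent_explicit by blast
qed

lemma cinner_proj_on_right:
  "cinner y (proj_on I e x) = (\<Sum>i\<in>I. cinner y (e i) * cinner (e i) x)"
  by (simp add: proj_on_def cinner_sum_right cinner_simps mult.commute)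

lemma proj_on_add: "proj_on I e (x + y) = proj_on I e x + proj_on I e y"
  by (simp add: proj_on_def cinner_simps cvs.scale_left_distrib sum.distrib)

lemma proj_on_scaleC: "proj_on I e (scaleC a x) = scaleC a (proj_on I e x)"
  by (simp add: proj_on_def cinner_simps cvs.scale_sum_right)

lemma proj_on_adjoint: "cinner (proj_on I e x) y = cinner x (proj_on I e y)"
proof -
  have "cinner (proj_on I e x) y = (\<Sum>i\<in>I. cinner x (e i) * cinner (e i) y)"
    by (simp add: proj_on_def cinner_sum_left cinner_simps flip: cinner_commute)
  then show ?thesis by (simp add: cinner_proj_on_right)
qed

lemma cinner_basis_proj_on:
  assumes "orthonormal_on J e" "finite I" "I \<subseteq> J" "k \<in> J"
  shows "cinner (e k) (proj_on I e x) = (if k \<in> I then cinner (e k) x else 0)"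
proof -
  have "cinner (e k) (proj_on I e x) = (\<Sum>i\<in>I. if k = i then cinner (e i) x else 0)"
    unfolding cinner_proj_on_right using assms
    by (intro sum.cong refl) (auto simp: orthonormal_onD[OF assms(1)])
  then show ?thesis using assms(2) by simp
qed

text \<open>Identities between projected vectors thus reduce to comparing coefficients; idempotence
  and the compression identity are obtained in this way.\<close>

lemma proj_on_cong:
  "(\<And>i. i \<in> I \<Longrightarrow> cinner (e i) x = cinner (e i) y) \<Longrightarrow> proj_on I e x = proj_on I e y"
  by (simp add: proj_on_def)

lemma orth_proj_proj_on:
  assumes "orthonormal_on I e" "finite I"
  shows "orth_proj (proj_on I e)"
  using cinner_basis_proj_on[OF assms order_refl]
  by (intro orth_projI proj_on_add proj_on_scaleC proj_on_adjoint proj_on_cong) simp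

text \<open>The larger index set \<open>J\<close> allows a partial projection of an orthonormal
  sequence to be evaluated at any member of the sequence.\<close>

lemma proj_on_basis:
  assumes "orthonormal_on J e" "finite I" "I \<subseteq> J" "k \<in> J"
  shows "proj_on I e (e k) = (if k \<in> I then e k else 0)"
proof -
  have "proj_on I e (e k) = (\<Sum>i\<in>I. if k = i then e i else 0)"
    unfolding proj_on_def using assms
    by (intro sum.cong refl) (auto simp: orthonormal_onD[OF assms(1)])
  then show ?thesis using assms(2) by simp
qed

lemma proj_on_in_span: "proj_on I e x \<in> cvs.span (e ` I)"
  unfolding proj_on_def by (intro cvs.span_sum cvs.span_scale cvs.span_base) simp

lemma proj_on_id:
  assumes "orthonormal_on I e" "finite I" "x \<in> cvs.span (e ` I)"
  shows "proj_on I e x = x"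
  using assms(3)
proof (induction rule: cvs.span_induct_alt)
  case base
  show ?case by (simp add: proj_on_def)
next
  case (step c v y)
  then show ?case
    using proj_on_basis[OF assms(1,2) order_refl] by (auto simp: proj_on_add proj_on_scaleC)
qed

lemma has_rank_proj_on:
  assumes "orthonormal_on I e" "finite I"
  shows "has_rank (proj_on I e) (card I)"
proof -
  have "cspan (e ` I) = range (proj_on I e)"
    using proj_on_id[OF assms] proj_on_in_span[of I e]
    by (auto simp: cspan_eq_span) (metis rangeI)
  then show ?thesis
    unfolding has_rank_def cindependent_iff using assms
    by (intro exI[of _ "e ` I"]) (simp add: orthonormal_on_independent card_image orthonormal_on_inj_on)
qed

text \<open>Since the projection of \<open>x\<close> is orthogonal to the remainder, the squared
  norm of the remainder is the difference of the other two and is nonnegative. The second claim is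
  used to measure blocks of partial sums.\<close>

lemma Bessel_inequality:
  assumes "orthonormal_on I e" "finite I"
  shows "(\<Sum>i\<in>I. (cmod (cinner (e i) x))\<^sup>2) \<le> (cnorm x)\<^sup>2"
    and "(cnorm (proj_on I e x))\<^sup>2 = (\<Sum>i\<in>I. (cmod (cinner (e i) x))\<^sup>2)"
proof -
  let ?P = "proj_on I e"
  have "cinner (?P x) (?P x) = cinner x (?P x)"
    using orth_proj_proj_on[OF assms] by (simp add: proj_on_adjoint orth_proj_def)
  moreover have "cinner x (?P x) = (\<Sum>i\<in>I. complex_of_real ((cmod (cinner (e i) x))\<^sup>2))"
    unfolding cinner_proj_on_right
    by (intro sum.cong refl) (metis cinner_commute complex_norm_square mult.commute)
  ultimately show eq: "(cnorm (?P x))\<^sup>2 = (\<Sum>i\<in>I. (cmod (cinner (e i) x))\<^sup>2)"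
    unfolding cnorm_square by (simp del: of_real_power)
  have "cinner x (?P x) = cinner (?P x) x" by (simp add: proj_on_adjoint)
  then have "(cnorm (x - ?P x))\<^sup>2 = (cnorm x)\<^sup>2 - (cnorm (?P x))\<^sup>2"
    using \<open>cinner (?P x) (?P x) = cinner x (?P x)\<close> by (simp add: cnorm_square cinner_simps)
  then show "(\<Sum>i\<in>I. (cmod (cinner (e i) x))\<^sup>2) \<le> (cnorm x)\<^sup>2"
    using eq zero_le_power2[of "cnorm (x - ?P x)"] by linarith
qed

text \<open>The orthonormal family is a set indexed by itself. A new vector contributes its
  normalized remainder after projection, or nothing if the remainder vanishes.\<close>

lemma Gram_Schmidt:
  assumes "finite S"
  obtains E where "finite E" "orthonormal_on E (\<lambda>v. v)" "S \<subseteq> cvs.span E"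
proof -
  have "\<exists>E. finite E \<and> orthonormal_on E (\<lambda>v. v) \<and> S \<subseteq> cvs.span E"
    using assms
  proof (induction S)
    case empty
    show ?case by (rule exI[of _ "{}"]) (simp add: orthonormal_on_def)
  next
    case (insert s S)
    then obtain E where E: "finite E" "orthonormal_on E (\<lambda>v. v)" "S \<subseteq> cvs.span E" by blast
    define P where "P = proj_on E (\<lambda>v. v)"
    define r where "r = s - P s"
    define w where "w = scaleC (complex_of_real (1 / cnorm r)) r"
    have Ps: "P s \<in> cvs.span E" using proj_on_in_span[of E "\<lambda>v. v" s] by (simp add: P_def)
    show ?case
    proof (cases "r = 0")
      case True
      then show ?thesis using E Ps by (intro exI[of _ E]) (simp add: r_def)
    next
      case False
      have "cinner v w = 0" if "v \<in> E" for v
        using cinner_basis_proj_on[OF E(2,1) order_refl that, of s] that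
        by (simp add: w_def r_def P_def cinner_simps)
      moreover have "cinner w w = 1" unfolding w_def by (rule cinner_normalized[OF False])
      ultimately have "orthonormal_on (insert w E) (\<lambda>v. v)"
        using E(2) cinner_eq_zero_commute[of _ w] by (auto simp: orthonormal_on_def)
      moreover have "s = scaleC (complex_of_real (cnorm r)) w + P s"
        using False by (simp add: w_def r_def)
      then have "s \<in> cvs.span (insert w E)"
        using Ps cvs.span_mono[of E "insert w E"]
        by (metis cvs.span_add cvs.span_base cvs.span_scale insertI1 subsetD subset_insertI)
      moreover have "S \<subseteq> cvs.span (insert w E)"
        using E(3) cvs.span_mono[of E "insert w E"] by blast
      ultimately show ?thesis using E(1) by blast
    qed
  qed
  then show thesis using that by blast
qed


text \<open>Both sides are projections of vectors with equal coefficients: expanding the inner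
  projection and applying \<open>scalar_on\<close> leaves a single term.\<close>

lemma compresses_proj_on:
  assumes e: "orthonormal_on I e" "finite I" and A: "\<forall>j<length A. bounded_op (A ! j)"
    and a: "length a = length A" "scalar_on I e A a"
  shows "compresses (proj_on I e) A a"
  unfolding compresses_def
proof (intro conjI allI impI)
  fix j x assume j: "j < length A"
  let ?T = "A ! j"
  have "cinner (e i) (?T (proj_on I e x)) = complex_of_real (a ! j) * cinner (e i) x" if "i \<in> I" for i
  proof -
    have "?T (proj_on I e x) = (\<Sum>k\<in>I. scaleC (cinner (e k) x) (?T (e k)))"
      using A j by (simp add: proj_on_def bounded_op_sum bounded_op_scaleC)
    then have "cinner (e i) (?T (proj_on I e x)) = (\<Sum>k\<in>I. cinner (e k) x * cinner (e i) (?T (e k)))"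
      by (simp add: cinner_sum_right cinner_simps)
    also have "\<dots> = (\<Sum>k\<in>I. if i = k then complex_of_real (a ! j) * cinner (e k) x else 0)"
      by (intro sum.cong refl) (simp add: scalar_onD[OF a(2) j that])
    also have "\<dots> = complex_of_real (a ! j) * cinner (e i) x" using that e(2) by simp
    finally show ?thesis .
  qed
  then have "proj_on I e (?T (proj_on I e x)) = proj_on I e (scaleC (complex_of_real (a ! j)) x)"
    by (intro proj_on_cong) (simp add: cinner_simps)
  then show "proj_on I e (?T (proj_on I e x)) = scaleC (complex_of_real (a ! j)) (proj_on I e x)"
    by (simp add: proj_on_scaleC)
qed (use a in simp)

lemma rank_k_numrangeI:
  assumes "orthonormal_on I e" "finite I" "\<forall>j<length A. bounded_op (A ! j)"
    "length a = length A" "scalar_on I e A a"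
  shows "a \<in> rank_k_numrange (card I) A"
  using assms orth_proj_proj_on has_rank_proj_on compresses_proj_on
  unfolding rank_k_numrange_def by blast

section \<open>Projection onto the closed span of an orthonormal sequence\<close>

text \<open>The norm limit of the partial projections, selected by choice; completeness provides its
  existence in \<open>proj_seq_tendsto\<close>.\<close>

definition proj_seq :: "(nat \<Rightarrow> 'a::complex_inner) \<Rightarrow> 'a \<Rightarrow> 'a" where
  "proj_seq e x = (SOME L. (\<lambda>n. cnorm (proj_on {..<n} e x - L)) \<longlonglongrightarrow> 0)"

lemma proj_seq_tendsto:
  fixes e :: "nat \<Rightarrow> 'a::chilbert_space"
  assumes e: "orthonormal_on UNIV e"
  shows "(\<lambda>n. cnorm (proj_on {..<n} e x - proj_seq e x)) \<longlonglongrightarrow> 0"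
proof -
  define g where "g i = (cmod (cinner (e i) x))\<^sup>2" for i
  have "summable g"
    using Bessel_inequality(1)[OF orthonormal_on_subset[OF e]]
    by (intro summableI_nonneg_bounded[where x = "(cnorm x)\<^sup>2"]) (auto simp: g_def)
  have diff: "proj_on {..<n} e x - proj_on {..<m} e x = proj_on {m..<n} e x" if "m \<le> n" for m n
    unfolding proj_on_def lessThan_atLeast0 using that by (intro sum_diff_nat_ivl) simp_all
  \<comment> \<open>The difference of two partial projections is a projection onto a block of the
    sequence, so its norm is governed by a block of the summable series \<open>g\<close>.\<close>
  have norm: "(cnorm (proj_on {m..<n} e x))\<^sup>2 = sum g {m..<n}" for m n
    using Bessel_inequality(2)[OF orthonormal_on_subset[OF e subset_UNIV], of "{m..<n}" x]
    by (simp add: g_def)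
  have "\<exists>N. \<forall>m\<ge>N. \<forall>n\<ge>N. cnorm (proj_on {..<m} e x - proj_on {..<n} e x) < r" if "r > 0" for r
  proof -
    have "\<exists>N. \<forall>m\<ge>N. \<forall>n. norm (sum g {m..<n}) < r\<^sup>2"
      using \<open>summable g\<close> that unfolding summable_Cauchy by simp
    then obtain N where N: "\<And>m n. N \<le> m \<Longrightarrow> norm (sum g {m..<n}) < r\<^sup>2" by blast
    have small: "cnorm (proj_on {m..<n} e x) < r" if "N \<le> m" for m n
      using N[OF that, of n] \<open>r > 0\<close> by (intro power2_less_imp_less[of _ r]) (simp_all add: norm)
    have "cnorm (proj_on {..<m} e x - proj_on {..<n} e x) < r" if "N \<le> m" "N \<le> n" for m n
    proof (cases "m \<le> n")
      case True
      have "cnorm (proj_on {..<m} e x - proj_on {..<n} e x)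
          = cnorm (scaleC (- 1) (proj_on {..<n} e x - proj_on {..<m} e x))"
        by simp
      also have "\<dots> = cnorm (proj_on {m..<n} e x)"
        unfolding cnorm_scaleC diff[OF True] by simp
      finally show ?thesis using small that by simp
    next
      case False
      then show ?thesis using small that by (simp add: diff)
    qed
    then show ?thesis by blast
  qed
  then have "\<exists>L. (\<lambda>n. cnorm (proj_on {..<n} e x - L)) \<longlonglongrightarrow> 0"
    unfolding cnorm_def by (intro cauchy_convergent) auto
  then show ?thesis unfolding proj_seq_def by (rule someI_ex)
qed

text \<open>Norm convergence implies weak convergence by Cauchy-Schwarz. Properties of
  \<open>proj_seq\<close> are then derived from scalar limits and their uniqueness.\<close>

lemma cinner_proj_seq_tendsto:
  fixes e :: "nat \<Rightarrow> 'a::chilbert_space"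
  assumes e: "orthonormal_on UNIV e"
  shows "(\<lambda>n. cinner y (proj_on {..<n} e x)) \<longlonglongrightarrow> cinner y (proj_seq e x)"
proof -
  have "(\<lambda>n. cinner y (proj_on {..<n} e x) - cinner y (proj_seq e x)) \<longlonglongrightarrow> 0"
  proof (rule tendsto_0_le[where K = 1])
    show "(\<lambda>n. cnorm y * cnorm (proj_on {..<n} e x - proj_seq e x)) \<longlonglongrightarrow> 0"
      using tendsto_mult_right_zero[OF proj_seq_tendsto[OF e]] .
    show "\<forall>\<^sub>F n in sequentially. norm (cinner y (proj_on {..<n} e x) - cinner y (proj_seq e x))
        \<le> norm (cnorm y * cnorm (proj_on {..<n} e x - proj_seq e x)) * 1"
      using Cauchy_Schwarz_cinner[of y] by (simp flip: cinner_diff_right)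
  qed
  then show ?thesis by (simp add: LIM_zero_iff)
qed

lemma proj_seq_eqI:
  fixes e :: "nat \<Rightarrow> 'a::chilbert_space"
  assumes e: "orthonormal_on UNIV e"
    and "\<And>y. (\<lambda>n. cinner y (proj_on {..<n} e x)) \<longlonglongrightarrow> cinner y z"
  shows "proj_seq e x = z"
  using LIMSEQ_unique[OF cinner_proj_seq_tendsto[OF e] assms(2)] by (rule cinner_extensionality)

lemma proj_seq_cong:
  fixes e :: "nat \<Rightarrow> 'a::chilbert_space"
  assumes "\<And>i. cinner (e i) x = cinner (e i) y"
  shows "proj_seq e x = proj_seq e y"
  using assms by (simp add: proj_seq_def proj_on_def)

lemma proj_seq_scaleC:
  fixes e :: "nat \<Rightarrow> 'a::chilbert_space"
  assumes e: "orthonormal_on UNIV e"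
  shows "proj_seq e (scaleC c x) = scaleC c (proj_seq e x)"
  by (rule proj_seq_eqI[OF e])
    (simp add: proj_on_scaleC cinner_simps tendsto_mult_left cinner_proj_seq_tendsto[OF e])

lemma proj_seq_basis:
  fixes e :: "nat \<Rightarrow> 'a::chilbert_space"
  assumes e: "orthonormal_on UNIV e"
  shows "proj_seq e (e i) = e i"
proof (rule proj_seq_eqI[OF e])
  fix y
  have "\<forall>\<^sub>F n in sequentially. cinner y (proj_on {..<n} e (e i)) = cinner y (e i)"
    using eventually_gt_at_top[of i] by eventually_elim (simp add: proj_on_basis[OF e])
  then show "(\<lambda>n. cinner y (proj_on {..<n} e (e i))) \<longlonglongrightarrow> cinner y (e i)"
    by (rule tendsto_eventually)
qed

lemma proj_seq_adjoint:
  fixes e :: "nat \<Rightarrow> 'a::chilbert_space"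
  assumes e: "orthonormal_on UNIV e"
  shows "cinner (proj_seq e x) y = cinner x (proj_seq e y)"
proof (rule LIMSEQ_unique)
  show "(\<lambda>n. cinner x (proj_on {..<n} e y)) \<longlonglongrightarrow> cinner x (proj_seq e y)"
    by (rule cinner_proj_seq_tendsto[OF e])
  have "(\<lambda>n. cnj (cinner y (proj_on {..<n} e x))) \<longlonglongrightarrow> cnj (cinner y (proj_seq e x))"
    by (intro tendsto_cnj cinner_proj_seq_tendsto[OF e])
  then show "(\<lambda>n. cinner x (proj_on {..<n} e y)) \<longlonglongrightarrow> cinner (proj_seq e x) y"
    by (simp add: proj_on_adjoint flip: cinner_commute)
qed

lemma cinner_basis_proj_seq:
  fixes e :: "nat \<Rightarrow> 'a::chilbert_space"
  assumes e: "orthonormal_on UNIV e"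
  shows "cinner (e i) (proj_seq e x) = cinner (e i) x"
  by (metis proj_seq_adjoint[OF e] proj_seq_basis[OF e])

lemma orth_proj_proj_seq:
  fixes e :: "nat \<Rightarrow> 'a::chilbert_space"
  assumes e: "orthonormal_on UNIV e"
  shows "orth_proj (proj_seq e)"
proof (rule orth_projI)
  show "proj_seq e (x + y) = proj_seq e x + proj_seq e y" for x y
    by (rule proj_seq_eqI[OF e])
      (simp add: proj_on_add cinner_simps tendsto_add cinner_proj_seq_tendsto[OF e])
  show "proj_seq e (proj_seq e x) = proj_seq e x" for x
    by (rule proj_seq_cong) (simp add: cinner_basis_proj_seq[OF e])
qed (simp_all add: proj_seq_scaleC[OF e] proj_seq_adjoint[OF e])

text \<open>As in the finite case, but instead of expanding the operator along an infinite sum,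
  self-adjointness moves it onto \<open>e i\<close>, and the identity for partial projections passes
  to the weak limit.\<close>

lemma compresses_proj_seq:
  fixes e :: "nat \<Rightarrow> 'a::chilbert_space"
  assumes e: "orthonormal_on UNIV e" and A: "\<forall>j<length A. self_adjoint (A ! j)"
    and a: "length a = length A" "scalar_on UNIV e A a"
  shows "compresses (proj_seq e) A a"
  unfolding compresses_def
proof (intro conjI allI impI)
  fix j x assume j: "j < length A"
  let ?T = "A ! j"
  have "cinner (e i) (?T (proj_seq e x)) = complex_of_real (a ! j) * cinner (e i) x" for i
  proof -
    have "cinner (?T (e i)) (e k) = complex_of_real (a ! j) * of_bool (i = k)" for k
      using A j scalar_onD[OF a(2) j] by (simp add: self_adjointD)
    then have "cinner (?T (e i)) (proj_on {..<n} e x) = complex_of_real (a ! j) * cinner (e i) (proj_on {..<n} e x)"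
      for n unfolding cinner_proj_on_right sum_distrib_left
      by (intro sum.cong refl) (simp add: orthonormal_onD[OF e])
    then have "(\<lambda>n. complex_of_real (a ! j) * cinner (e i) (proj_on {..<n} e x))
        \<longlonglongrightarrow> cinner (?T (e i)) (proj_seq e x)"
      using cinner_proj_seq_tendsto[OF e, of "?T (e i)" x] by simp
    moreover have "(\<lambda>n. complex_of_real (a ! j) * cinner (e i) (proj_on {..<n} e x))
        \<longlonglongrightarrow> complex_of_real (a ! j) * cinner (e i) (proj_seq e x)"
      by (intro tendsto_mult_left cinner_proj_seq_tendsto[OF e])
    ultimately have "cinner (?T (e i)) (proj_seq e x) = complex_of_real (a ! j) * cinner (e i) (proj_seq e x)"
      by (rule LIMSEQ_unique)
    then show ?thesis using A j by (simp add: self_adjointD cinner_basis_proj_seq[OF e])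
  qed
  then have "proj_seq e (?T (proj_seq e x)) = proj_seq e (scaleC (complex_of_real (a ! j)) x)"
    by (intro proj_seq_cong) (simp add: cinner_simps)
  then show "proj_seq e (?T (proj_seq e x)) = scaleC (complex_of_real (a ! j)) (proj_seq e x)"
    by (simp add: proj_seq_scaleC[OF e])
qed (use a in simp)

text \<open>The range contains the whole sequence, an infinite independent set, which no finite set
  can span.\<close>

lemma infinite_rank_proj_seq:
  fixes e :: "nat \<Rightarrow> 'a::chilbert_space"
  assumes e: "orthonormal_on UNIV e"
  shows "infinite_rank (proj_seq e)"
proof -
  have "range e \<subseteq> range (proj_seq e)"
    using proj_seq_basis[OF e] by (metis image_subsetI rangeI)
  moreover have "infinite (range e)"
    using orthonormal_on_inj_on[OF e] by (simp add: finite_image_iff)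
  moreover have "finite (range e)" if "finite S" "range e \<subseteq> cvs.span S" for S
    using cvs.independent_span_bound[OF that(1) orthonormal_on_independent[OF e] that(2)] by simp
  ultimately show ?thesis
    unfolding infinite_rank_def cspan_eq_span by (meson order_trans)
qed

lemma infty_numrangeI:
  fixes e :: "nat \<Rightarrow> 'a::chilbert_space"
  assumes "orthonormal_on UNIV e" "\<forall>j<length A. self_adjoint (A ! j)"
    "length a = length A" "scalar_on UNIV e A a"
  shows "a \<in> infty_numrange A"
  using assms orth_proj_proj_seq infinite_rank_proj_seq compresses_proj_seq
  unfolding infty_numrange_def by blast

section \<open>Subspaces of finite codimension\<close>

definition perp :: "'a::complex_inner set \<Rightarrow> 'a set" where
  "perp S = {x. \<forall>s\<in>S. cinner s x = 0}"

lemma subspace_perp: "cvs.subspace (perp S)"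
  by (simp add: cvs.subspace_def perp_def cinner_simps)

text \<open>Each orthogonality condition lowers the dimension by at most one: if
  \<open>cinner s\<close> is nonzero at some \<open>v\<close>, subtracting a multiple of
  \<open>v\<close> moves any vector into its kernel. The cardinality bound is what permits dimension
  counts in finite-dimensional \<open>M\<close>.\<close>

lemma span_perp_codim:
  assumes "finite S" "cvs.subspace M" "finite T" "M \<inter> perp S \<subseteq> cvs.span T"
  shows "\<exists>T'. finite T' \<and> M \<subseteq> cvs.span T' \<and> card T' \<le> card T + card S"
  using assms(1,3,4)
proof (induction S arbitrary: T)
  case empty
  then show ?case by (auto simp: perp_def)
next
  case (insert s S)
  define N where "N = M \<inter> perp S"
  have N: "cvs.subspace N" unfolding N_def using assms(2) subspace_perp by (rule cvs.subspace_inter)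
  have NT: "x \<in> cvs.span T" if "x \<in> N" "cinner s x = 0" for x
    using insert.prems(2) that by (auto simp: N_def perp_def)
  have "\<exists>v. N \<subseteq> cvs.span (insert v T)"
  proof (cases "\<exists>v\<in>N. cinner s v \<noteq> 0")
    case True
    then obtain v where v: "v \<in> N" "cinner s v \<noteq> 0" by blast
    have "x \<in> cvs.span (insert v T)" if "x \<in> N" for x
    proof -
      define k where "k = cinner s x / cinner s v"
      have "x - scaleC k v \<in> N"
        using N that v(1) by (intro cvs.subspace_diff cvs.subspace_scale)
      moreover have "cinner s (x - scaleC k v) = 0" using v(2) by (simp add: k_def cinner_simps)
      ultimately show ?thesis using NT cvs.span_breakdown_eq by blast
    qed
    then show ?thesis by blast
  next
    case False
    \<comment> \<open>The condition for \<open>s\<close> already holds on \<open>N\<close>; the zero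
      vector is inserted only to match the shape of the other case.\<close>
    then show ?thesis using NT cvs.span_mono[of T "insert 0 T"] by blast
  qed
  then obtain v where "M \<inter> perp S \<subseteq> cvs.span (insert v T)" by (auto simp: N_def)
  then obtain T' where "finite T'" "M \<subseteq> cvs.span T'" "card T' \<le> card (insert v T) + card S"
    using insert.IH[of "insert v T"] insert.prems(1) by blast
  moreover have "card (insert v T) \<le> Suc (card T)" by (rule card_insert_le_m1) simp_all
  ultimately show ?case using insert.hyps by (intro exI[of _ T']) simp
qed

text \<open>If \<open>M\<close> met \<open>perp S\<close> only in 0, then \<open>M\<close> would be
  spanned by at most \<open>card S\<close> vectors. The next two lemmas apply this to
  infinite-dimensional \<open>M\<close> and to spans of finite orthonormal families.\<close>

lemma unit_vector_perp:
  assumes "cvs.subspace M" "finite S"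
    and "\<And>T. finite T \<Longrightarrow> M \<subseteq> cvs.span T \<Longrightarrow> \<not> card T \<le> card S"
  obtains x where "x \<in> M" "x \<in> perp S" "cinner x x = 1"
proof -
  have "\<not> M \<inter> perp S \<subseteq> cvs.span {}"
    using span_perp_codim[OF assms(2,1), of "{}"] assms(3) by auto
  then obtain y where y: "y \<in> M" "y \<in> perp S" "y \<noteq> 0" by auto
  show thesis
    by (rule that[OF _ _ cinner_normalized[OF y(3)]])
      (use y assms(1) subspace_perp cvs.subspace_scale in blast)+
qed

lemma unit_vector_perp_infinite:
  assumes "cvs.subspace M" "finite S" "\<nexists>T. finite T \<and> M \<subseteq> cvs.span T"
  obtains x where "x \<in> M" "x \<in> perp S" "cinner x x = 1"
  using unit_vector_perp[OF assms(1,2)] assms(3) by blast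

lemma unit_vector_perp_orthonormal:
  assumes e: "orthonormal_on I e" "finite I" and S: "finite S" "card S < card I"
  obtains x where "x \<in> cvs.span (e ` I)" "x \<in> perp S" "cinner x x = 1"
proof (rule unit_vector_perp[OF cvs.subspace_span S(1)])
  fix T assume T: "finite T" "cvs.span (e ` I) \<subseteq> cvs.span T"
  have "e ` I \<subseteq> cvs.span T" using T(2) cvs.span_superset by blast
  then have "card (e ` I) \<le> card T"
    using cvs.independent_span_bound[OF T(1) orthonormal_on_independent[OF e(1)]] by blast
  then show "\<not> card T \<le> card S" using S(2) by (simp add: card_image orthonormal_on_inj_on[OF e(1)])
qed (use that in blast)

text \<open>Choose each vector orthogonal to its predecessors and to their images under the
  operators, finitely many conditions each time. Self-adjointness gives the entries on the other
  side of the diagonal. \<open>Q\<close> is any property to be imposed on every vector.\<close>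

lemma diagonal_sequence:
  fixes Q :: "'a::complex_inner \<Rightarrow> bool"
  assumes Q: "\<And>S. finite S \<Longrightarrow> \<exists>x. Q x \<and> x \<in> perp S \<and> cinner x x = 1"
    and \<T>: "finite \<T>" "\<And>T. T \<in> \<T> \<Longrightarrow> self_adjoint T"
  obtains e :: "nat \<Rightarrow> 'a" where "orthonormal_on UNIV e" "\<And>i. Q (e i)"
    "\<And>T i k. T \<in> \<T> \<Longrightarrow> i \<noteq> k \<Longrightarrow> cinner (e i) (T (e k)) = 0"
proof -
  define S where "S f i = (\<Union>k<i. insert (f k) ((\<lambda>T. T (f k)) ` \<T>))" for f :: "nat \<Rightarrow> 'a" and i
  have "\<exists>e. \<forall>i. Q (e i) \<and> e i \<in> perp (S e i) \<and> cinner (e i) (e i) = 1"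
  proof (rule dependent_wellorder_choice)
    \<comment> \<open>The choice principle requires that the condition at \<open>i\<close> depend
      only on the values chosen below \<open>i\<close>.\<close>
    show "(Q r \<and> r \<in> perp (S f i) \<and> cinner r r = 1) = (Q r \<and> r \<in> perp (S g i) \<and> cinner r r = 1)"
      if "\<And>k. k < i \<Longrightarrow> f k = g k" for r f g i
      using that by (simp add: S_def)
    show "\<exists>r. Q r \<and> r \<in> perp (S f i) \<and> cinner r r = 1" for i f
      using \<T>(1) by (intro Q) (simp add: S_def)
  qed
  then obtain e where e: "\<And>i. Q (e i)" "\<And>i. e i \<in> perp (S e i)" "\<And>i. cinner (e i) (e i) = 1"
    by blast
  have less_op: "cinner (T (e k)) (e i) = 0" if "k < i" "T \<in> \<T>" for i k T
    using e(2)[of i] that by (auto simp: perp_def S_def)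
  have less: "cinner (e k) (e i) = 0" if "k < i" for i k
    using e(2)[of i] that by (auto simp: perp_def S_def)
  have "cinner (e i) (e k) = of_bool (i = k)" for i k
    using less[of i k] less[of k i] e(3) cinner_eq_zero_commute[of "e i" "e k"]
    by (cases i k rule: linorder_cases) auto
  then have "orthonormal_on UNIV e" by (simp add: orthonormal_on_def)
  moreover have "cinner (e i) (T (e k)) = 0" if "T \<in> \<T>" "i \<noteq> k" for T i k
  proof (cases "i < k")
    case True
    then have "cinner (T (e i)) (e k) = 0" using less_op that(1) by blast
    then show ?thesis using \<T>(2)[OF that(1)] by (simp add: self_adjointD)
  next
    case False
    then have "cinner (T (e k)) (e i) = 0" using less_op[of k i T] that by simp
    then show ?thesis by (simp add: cinner_eq_zero_commute)
  qed
  ultimately show thesis using that e(1) by blast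
qed

section \<open>Scalar compressions of finite rank\<close>

text \<open>Sort the \<open>2 * N\<close> indices by \<open>d\<close>: \<open>lo\<close> enumerates
  the lower half, \<open>hi\<close> the upper half, and \<open>x\<close> is the value at position
  \<open>N\<close>.\<close>

lemma pairing_around_median:
  fixes d :: "nat \<Rightarrow> real"
  obtains lo hi x where "inj_on lo {..<N}" "inj_on hi {..<N}"
    "\<And>s t. s < N \<Longrightarrow> t < N \<Longrightarrow> lo s \<noteq> hi t"
    "\<And>s. s < N \<Longrightarrow> lo s < 2 * N \<and> hi s < 2 * N \<and> d (lo s) \<le> x \<and> x \<le> d (hi s)"
proof -
  define xs where "xs = sort_key d [0..<2 * N]"
  have len: "length xs = 2 * N" and dist: "distinct xs" and set: "set xs = {..<2 * N}"
    by (auto simp: xs_def)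
  have mono: "d (xs ! i) \<le> d (xs ! k)" if "i \<le> k" "k < 2 * N" for i k
    using sorted_nth_mono[of "map d xs" i k] that len by (simp add: xs_def)
  have range: "xs ! i < 2 * N" if "i < 2 * N" for i
    using nth_mem[of i xs] that len set by simp
  have eq: "xs ! i = xs ! k \<longleftrightarrow> i = k" if "i < 2 * N" "k < 2 * N" for i k
    using nth_eq_iff_index_eq[OF dist] that len by simp
  show thesis
    by (rule that[of "\<lambda>s. xs ! s" "\<lambda>s. xs ! (N + s)" "d (xs ! N)"])
      (auto simp: inj_on_def eq range intro!: mono)
qed

lemma convex_weight:
  fixes a b x :: real
  assumes "a \<le> x" "x \<le> b"
  obtains p where "0 \<le> p" "p \<le> 1" "p * a + (1 - p) * b = x"
proof (cases "a = b")
  case True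
  then show thesis using assms by (intro that[of 0]) simp_all
next
  case False
  define p where "p = (b - x) / (b - a)"
  have "0 < b - a" using False assms by simp
  then have "p * (b - a) = b - x" "0 \<le> p" "p \<le> 1" using assms by (simp_all add: p_def)
  then show thesis by (intro that[of p]) (simp_all add: algebra_simps)
qed

lemma cinner_combination:
  assumes "bounded_op T"
  shows "cinner (scaleC (complex_of_real a) u + scaleC (complex_of_real b) v)
      (T (scaleC (complex_of_real a') u' + scaleC (complex_of_real b') v')) =
    complex_of_real (a * a') * cinner u (T u') + complex_of_real (a * b') * cinner u (T v') +
    complex_of_real (b * a') * cinner v (T u') + complex_of_real (b * b') * cinner v (T v')"
  by (simp add: bounded_op_add[OF assms] bounded_op_scaleC[OF assms] cinner_simps algebra_simps)

text \<open>One operator at a time: combining each of the \<open>N\<close> smallest diagonal entries of the new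
  operator with one of the \<open>N\<close> largest makes its diagonal constant, at the price of halving the
  family, and leaves the diagonals that are already constant unchanged.\<close>

lemma exists_scalar_compression:
  fixes S :: "'a::complex_inner set"
  assumes inf: "infinite_dimensional TYPE('a)" and S: "finite S"
    and \<T>: "finite \<T>" "\<And>T. T \<in> \<T> \<Longrightarrow> self_adjoint T"
  obtains f :: "nat \<Rightarrow> 'a" and c where "orthonormal_on {..<N} f" "f ` {..<N} \<subseteq> perp S"
    "\<And>T i k. T \<in> \<T> \<Longrightarrow> i < N \<Longrightarrow> k < N \<Longrightarrow> cinner (f i) (T (f k)) = complex_of_real (c T) * of_bool (i = k)"
proof -
  have "\<exists>x. x \<in> perp S \<and> x \<in> perp S' \<and> cinner x x = 1" if "finite S'" for S'
  proof -
    have nospan: "\<nexists>T. finite T \<and> (UNIV :: 'a set) \<subseteq> cvs.span T"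
      using inf by (auto simp: infinite_dimensional_def cspan_eq_span)
    have "finite (S \<union> S')" using S that by simp
    then obtain x where "x \<in> UNIV" "x \<in> perp (S \<union> S')" "cinner x x = 1"
      by (rule unit_vector_perp_infinite[OF cvs.subspace_UNIV _ nospan])
    then show ?thesis by (auto simp: perp_def)
  qed
  then obtain e :: "nat \<Rightarrow> 'a" where e: "orthonormal_on UNIV e" "\<And>i. e i \<in> perp S"
      "\<And>T i k. T \<in> \<T> \<Longrightarrow> i \<noteq> k \<Longrightarrow> cinner (e i) (T (e k)) = 0"
    using diagonal_sequence[of "\<lambda>x. x \<in> perp S" \<T>] \<T> by metis
  \<comment> \<open>The invariant of the induction: all operators in \<open>\<T>\<close>, including
    those not yet treated, have vanishing off-diagonal entries on the family.\<close>
  define diag where "diag f N \<longleftrightarrow> orthonormal_on {..<N} f \<and> f ` {..<N} \<subseteq> perp S \<and>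
      (\<forall>T\<in>\<T>. \<forall>i<N. \<forall>k<N. i \<noteq> k \<longrightarrow> cinner (f i) (T (f k)) = 0)" for f :: "nat \<Rightarrow> 'a" and N
  have "\<exists>f c. diag f N \<and> (\<forall>T\<in>\<U>. \<forall>i<N. cinner (f i) (T (f i)) = complex_of_real (c T))"
    if "finite \<U>" "\<U> \<subseteq> \<T>" for \<U> N
    using that
  proof (induction \<U> arbitrary: N)
    case empty
    have "diag e N"
      using e orthonormal_on_subset[OF e(1)] by (auto simp: diag_def)
    then show ?case by blast
  next
    case (insert T \<U>)
    obtain f c where f: "diag f (2 * N)"
      and c: "\<And>U i. U \<in> \<U> \<Longrightarrow> i < 2 * N \<Longrightarrow> cinner (f i) (U (f i)) = complex_of_real (c U)"
      using insert.IH[of "2 * N"] insert.prems by blast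
    have T: "self_adjoint T" using insert.prems \<T>(2) by blast
    define d where "d i = Re (cinner (f i) (T (f i)))" for i
    have d: "cinner (f i) (T (f i)) = complex_of_real (d i)" for i
      unfolding d_def by (rule self_adjoint_form_real[OF T])
    obtain lo hi x where inj: "inj_on lo {..<N}" "inj_on hi {..<N}"
        "\<And>s t. s < N \<Longrightarrow> t < N \<Longrightarrow> lo s \<noteq> hi t"
      and lohi: "\<And>s. s < N \<Longrightarrow> lo s < 2 * N \<and> hi s < 2 * N \<and> d (lo s) \<le> x \<and> x \<le> d (hi s)"
      using pairing_around_median[of N d] by blast
    have "\<forall>s. \<exists>p. s < N \<longrightarrow> 0 \<le> p \<and> p \<le> 1 \<and> p * d (lo s) + (1 - p) * d (hi s) = x"
      using lohi convex_weight by metis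
    then obtain p where p: "\<And>s. s < N \<Longrightarrow> 0 \<le> p s \<and> p s \<le> 1 \<and> p s * d (lo s) + (1 - p s) * d (hi s) = x"
      by metis
    \<comment> \<open>The coefficients are square roots because the form is quadratic: once the
      cross terms vanish, the diagonal entry is the convex combination with weights
      \<open>p s\<close> and \<open>1 - p s\<close>, which is \<open>x\<close> for
      \<open>T\<close>.\<close>
    define g where "g s = scaleC (complex_of_real (sqrt (p s))) (f (lo s))
        + scaleC (complex_of_real (sqrt (1 - p s))) (f (hi s))" for s
    \<comment> \<open>Stated for any bounded \<open>U\<close> with vanishing off-diagonal entries,
      so that the identity operator is covered too and yields orthonormality of
      \<open>g\<close>.\<close>
    have form: "cinner (g s) (U (g t)) = (if s = t then complex_of_real (p s) * cinner (f (lo s)) (U (f (lo s)))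
          + complex_of_real (1 - p s) * cinner (f (hi s)) (U (f (hi s))) else 0)"
      if U: "bounded_op U" "\<And>i k. i < 2 * N \<Longrightarrow> k < 2 * N \<Longrightarrow> i \<noteq> k \<Longrightarrow> cinner (f i) (U (f k)) = 0"
        and st: "s < N" "t < N" for U s t
    proof (cases "s = t")
      case True
      have "lo s \<noteq> hi s" using inj(3) st by blast
      then have "cinner (f (lo s)) (U (f (hi s))) = 0" "cinner (f (hi s)) (U (f (lo s))) = 0"
        using U(2) lohi st by metis+
      moreover have "sqrt (p s) * sqrt (p s) = p s" "sqrt (1 - p s) * sqrt (1 - p s) = 1 - p s"
        using p[OF st(1)] by simp_all
      ultimately show ?thesis using True
        unfolding g_def cinner_combination[OF U(1)] by (simp del: of_real_mult of_real_diff)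
    next
      case False
      \<comment> \<open>Different pairs share no index, so all four terms of the expansion are
        off-diagonal entries.\<close>
      have "lo s \<noteq> hi t" "hi s \<noteq> lo t" "lo s \<noteq> lo t" "hi s \<noteq> hi t"
        using inj False st by (auto simp: inj_on_def) metis
      then have "cinner (f (lo s)) (U (f (hi t))) = 0" "cinner (f (hi s)) (U (f (lo t))) = 0"
          "cinner (f (lo s)) (U (f (lo t))) = 0" "cinner (f (hi s)) (U (f (hi t))) = 0"
        using U(2) lohi st by metis+
      then show ?thesis using False unfolding g_def cinner_combination[OF U(1)] by simp
    qed
    have offdiag: "cinner (f i) (U (f k)) = 0" if "U \<in> \<T>" "i < 2 * N" "k < 2 * N" "i \<noteq> k" for U i k
      using f that by (simp add: diag_def)
    have bounded: "bounded_op U" if "U \<in> \<T>" for U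
      using \<T>(2)[OF that] by (rule self_adjoint_bounded)
    have form_\<T>: "cinner (g s) (U (g t)) = (if s = t then complex_of_real (p s) * cinner (f (lo s)) (U (f (lo s)))
          + complex_of_real (1 - p s) * cinner (f (hi s)) (U (f (hi s))) else 0)"
      if "U \<in> \<T>" "s < N" "t < N" for U s t
      by (rule form) (use that bounded offdiag in auto)
    have ortho: "cinner (f i) (f k) = of_bool (i = k)" if "i < 2 * N" "k < 2 * N" for i k
      using f that unfolding diag_def by (auto simp: orthonormal_onD)
    have "cinner (g s) (g t) = of_bool (s = t)" if "s < N" "t < N" for s t
    proof -
      have "cinner (g s) (g t) = (if s = t then complex_of_real (p s) * cinner (f (lo s)) (f (lo s))
          + complex_of_real (1 - p s) * cinner (f (hi s)) (f (hi s)) else 0)"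
        by (rule form) (use that ortho self_adjoint_bounded[OF self_adjoint_id] in auto)
      moreover have "cinner (f (lo s)) (f (lo s)) = 1" "cinner (f (hi s)) (f (hi s)) = 1"
        using ortho lohi[OF that(1)] by simp_all
      ultimately show ?thesis by (cases "s = t") simp_all
    qed
    moreover have "g s \<in> perp S" if "s < N" for s
    proof -
      have "f (lo s) \<in> perp S" "f (hi s) \<in> perp S"
        using f lohi[OF that] by (auto simp: diag_def)
      then show ?thesis unfolding g_def
        by (intro cvs.subspace_add cvs.subspace_scale subspace_perp)
    qed
    moreover have "cinner (g s) (U (g t)) = 0" if "U \<in> \<T>" "s < N" "t < N" "s \<noteq> t" for U s t
      using form_\<T>[OF that(1-3)] that(4) by simp
    ultimately have "diag g N"
      by (auto simp: diag_def orthonormal_on_def)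
    moreover have "cinner (g s) (U (g s)) = complex_of_real (c U)" if "U \<in> \<U>" "s < N" for U s
    proof -
      have "U \<in> \<T>" using that(1) insert.prems by blast
      then have "cinner (g s) (U (g s)) = complex_of_real (p s) * complex_of_real (c U)
          + complex_of_real (1 - p s) * complex_of_real (c U)"
        using form_\<T>[OF _ that(2) that(2), of U] c[OF that(1)] lohi[OF that(2)] by simp
      \<comment> \<open>A convex combination of two equal diagonal entries is that same value, so
        earlier operators stay scalar.\<close>
      then show ?thesis by (simp add: algebra_simps)
    qed
    moreover have "cinner (g s) (T (g s)) = complex_of_real x" if "s < N" for s
    proof -
      have "cinner (g s) (T (g s)) = complex_of_real (p s * d (lo s) + (1 - p s) * d (hi s))"
        using form_\<T>[OF _ that that, of T] insert.prems by (simp add: d)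
      then show ?thesis using p[OF that] by simp
    qed
    ultimately show ?case
      using insert.hyps by (intro exI[of _ g] exI[of _ "c(T := x)"]) auto
  qed
  from this[OF \<T>(1) order_refl, of N] obtain f c where f: "diag f N"
    "\<forall>T\<in>\<T>. \<forall>i<N. cinner (f i) (T (f i)) = complex_of_real (c T)" by blast
  show thesis
    by (rule that[of f c]) (use f in \<open>auto simp: diag_def\<close>)
qed

section \<open>Joint numerical ranges and finite rank perturbations\<close>

text \<open>As \<open>n\<close> is positive, the projection fixes some unit vector \<open>z\<close>,
  and moving \<open>P\<close> across the inner product turns the value at \<open>z\<close> into that
  of the scalar compression.\<close>

lemma rank_k_numrange_unit_vector:
  assumes a: "a \<in> rank_k_numrange n A" and n: "n \<ge> 1"
  obtains z where "cinner z z = 1" "\<And>j. j < length A \<Longrightarrow> cinner z ((A ! j) z) = complex_of_real (a ! j)"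
proof -
  obtain P where P: "orth_proj P" "has_rank P n" "compresses P A a"
    using a by (auto simp: rank_k_numrange_def)
  obtain B where B: "card B = n" "cvs.independent B" "cvs.span B = range P"
    using P(2) by (auto simp: has_rank_def cindependent_iff cspan_eq_span)
  obtain b where b: "b \<in> B" using B(1) n by fastforce
  have "b \<noteq> 0" using b B(2) cvs.dependent_zero by blast
  have "b \<in> range P" using b B(3) cvs.span_base by blast
  define z where "z = scaleC (complex_of_real (1 / cnorm b)) b"
  have zz: "cinner z z = 1" unfolding z_def by (rule cinner_normalized[OF \<open>b \<noteq> 0\<close>])
  have sa: "self_adjoint P" and idem: "P (P x) = P x" for x using P(1) by (auto simp: orth_proj_def)
  have "P b = b" using \<open>b \<in> range P\<close> idem by auto
  then have Pz: "P z = z" by (simp add: z_def bounded_op_scaleC[OF self_adjoint_bounded[OF sa]])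
  show thesis
  proof (rule that[OF zz])
    fix j assume j: "j < length A"
    have "cinner z ((A ! j) z) = cinner z (P ((A ! j) (P z)))"
      by (simp add: Pz flip: self_adjointD[OF sa])
    also have "P ((A ! j) (P z)) = scaleC (complex_of_real (a ! j)) (P z)"
      using P(3) j by (simp add: compresses_def)
    also have "cinner z \<dots> = complex_of_real (a ! j)" using zz by (simp add: cinner_simps Pz)
    finally show "cinner z ((A ! j) z) = complex_of_real (a ! j)" .
  qed
qed

text \<open>The range of \<open>P\<close> is infinite-dimensional and so contains an orthonormal
  sequence orthogonal to \<open>S\<close>; on vectors fixed by \<open>P\<close> the compression
  identity gives the matrix entries.\<close>

lemma infty_numrange_sequence:
  assumes a: "a \<in> infty_numrange A" and S: "finite S"
  obtains e :: "nat \<Rightarrow> 'a::complex_inner" where "orthonormal_on UNIV e" "range e \<subseteq> perp S"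
    "scalar_on UNIV e A a"
proof -
  obtain P where P: "orth_proj P" "infinite_rank P" "compresses P A a"
    using a by (auto simp: infty_numrange_def)
  have sa: "self_adjoint P" and idem: "P (P x) = P x" for x using P(1) by (auto simp: orth_proj_def)
  have bd: "bounded_op P" by (rule self_adjoint_bounded[OF sa])
  have sub: "cvs.subspace (range P)"
    unfolding cvs.subspace_def
    by (auto simp flip: bounded_op_add[OF bd] bounded_op_scaleC[OF bd])
      (metis bounded_op_zero[OF bd] rangeI)
  have nospan: "\<nexists>T. finite T \<and> range P \<subseteq> cvs.span T"
    using P(2) by (simp add: infinite_rank_def cspan_eq_span)
  have perp: "\<exists>x. (P x = x \<and> x \<in> perp S) \<and> x \<in> perp S' \<and> cinner x x = 1"
    if "finite S'" for S'
  proof -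
    have "finite (S \<union> S')" using S that by simp
    then obtain x where "x \<in> range P" "x \<in> perp (S \<union> S')" "cinner x x = 1"
      by (rule unit_vector_perp_infinite[OF sub _ nospan])
    then show ?thesis using idem by (auto simp: perp_def)
  qed
  \<comment> \<open>The operator set is empty here: off-diagonal entries vanish because the
    compression to the range of \<open>P\<close> is already scalar.\<close>
  then obtain e :: "nat \<Rightarrow> 'a" where e: "orthonormal_on UNIV e" "\<And>i. P (e i) = e i \<and> e i \<in> perp S"
    using diagonal_sequence[of "\<lambda>x. P x = x \<and> x \<in> perp S" "{}"] by (metis empty_iff finite.emptyI)
  have "cinner (e i) ((A ! j) (e k)) = complex_of_real (a ! j) * of_bool (i = k)"
    if j: "j < length A" for i j k
  proof -
    have "cinner (e i) ((A ! j) (e k)) = cinner (e i) (P ((A ! j) (P (e k))))"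
      using e(2) by (simp flip: self_adjointD[OF sa])
    also have "P ((A ! j) (P (e k))) = scaleC (complex_of_real (a ! j)) (P (e k))"
      using P(3) j by (simp add: compresses_def)
    also have "cinner (e i) \<dots> = complex_of_real (a ! j) * of_bool (i = k)"
      using e(2) by (simp add: cinner_simps orthonormal_onD[OF e(1)])
    finally show ?thesis .
  qed
  then have "scalar_on UNIV e A a" by (simp add: scalar_on_def)
  moreover have "range e \<subseteq> perp S" using e(2) by blast
  ultimately show thesis using that e(1) by blast
qed

section \<open>Tuples perturbed by self-adjoint finite rank operators\<close>

lemma length_op_tuple_add:
  "F \<in> sa_finite_rank_tuples (length A) \<Longrightarrow> length (op_tuple_add A F) = length A"
  by (simp add: op_tuple_add_def sa_finite_rank_tuples_def)

lemma nth_op_tuple_add: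
  "F \<in> sa_finite_rank_tuples (length A) \<Longrightarrow> j < length A \<Longrightarrow>
    (op_tuple_add A F ! j) = (\<lambda>x. (A ! j) x + (F ! j) x)"
  by (simp add: op_tuple_add_def sa_finite_rank_tuples_def)

lemma self_adjoint_op_tuple_add:
  assumes "\<forall>j<length A. self_adjoint (A ! j)" "F \<in> sa_finite_rank_tuples (length A)"
  shows "\<forall>j<length (op_tuple_add A F). self_adjoint (op_tuple_add A F ! j)"
  using assms
  by (auto simp: length_op_tuple_add nth_op_tuple_add intro!: self_adjoint_plus)
    (simp add: sa_finite_rank_tuples_def)

text \<open>Taking the sequence orthogonal to spanning sets of the ranges of all components of
  \<open>F\<close> makes every component vanish on it, so both tuples have the same matrix entries
  there.\<close>

lemma infty_numrange_perturbation_sequence: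
  assumes a: "a \<in> infty_numrange A" and F: "F \<in> sa_finite_rank_tuples (length A)"
  obtains e :: "nat \<Rightarrow> 'a::complex_inner" where "orthonormal_on UNIV e"
    "scalar_on UNIV e (op_tuple_add A F) a"
proof -
  have "\<forall>j. \<exists>S. j < length A \<longrightarrow> finite S \<and> range (F ! j) \<subseteq> cspan S"
    using F by (auto simp: sa_finite_rank_tuples_def finite_rank_def)
  then obtain S where S: "\<And>j. j < length A \<Longrightarrow> finite (S j) \<and> range (F ! j) \<subseteq> cspan (S j)" by metis
  define R where "R = (\<Union>j<length A. S j)"
  have "finite R" using S by (simp add: R_def)
  then obtain e :: "nat \<Rightarrow> 'a" where e: "orthonormal_on UNIV e" "range e \<subseteq> perp R" "scalar_on UNIV e A a"
    using infty_numrange_sequence[OF a] by blast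
  have "(F ! j) (e k) = 0" if "j < length A" for j k
    using F that S[OF that] e(2)
    by (intro self_adjoint_eq_zero[of _ "S j"]) (auto simp: sa_finite_rank_tuples_def perp_def R_def)
  then have "scalar_on UNIV e (op_tuple_add A F) a"
    using e(3) by (simp add: scalar_on_def length_op_tuple_add[OF F] nth_op_tuple_add[OF F])
  then show thesis using that e(1) by blast
qed

text \<open>One sequence serves both inclusions: all of it for infinite rank, its first
  \<open>k\<close> vectors for rank \<open>k\<close>.\<close>

lemma infty_numrange_subset_perturbation:
  fixes A :: "('a::chilbert_space \<Rightarrow> 'a) list"
  assumes A: "\<forall>j<length A. self_adjoint (A ! j)" and F: "F \<in> sa_finite_rank_tuples (length A)"
  shows "infty_numrange A \<subseteq> infty_numrange (op_tuple_add A F)"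
    and "infty_numrange A \<subseteq> rank_k_numrange k (op_tuple_add A F)"
proof -
  have AF: "\<forall>j<length (op_tuple_add A F). self_adjoint (op_tuple_add A F ! j)"
    by (rule self_adjoint_op_tuple_add[OF A F])
  have "a \<in> infty_numrange (op_tuple_add A F) \<and> a \<in> rank_k_numrange k (op_tuple_add A F)"
    if a: "a \<in> infty_numrange A" for a
  proof -
    obtain e :: "nat \<Rightarrow> 'a" where e: "orthonormal_on UNIV e" "scalar_on UNIV e (op_tuple_add A F) a"
      using infty_numrange_perturbation_sequence[OF a F] by blast
    have len: "length a = length (op_tuple_add A F)"
      using a by (simp add: infty_numrange_def length_op_tuple_add[OF F])
    have "a \<in> rank_k_numrange (card {..<k}) (op_tuple_add A F)"
    proof (rule rank_k_numrangeI)
      show "orthonormal_on {..<k} e" by (rule orthonormal_on_subset[OF e(1) subset_UNIV])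
      show "scalar_on {..<k} e (op_tuple_add A F) a" using e(2) by (simp add: scalar_on_def)
    qed (use AF len self_adjoint_bounded in auto)
    then show ?thesis using infty_numrangeI[OF e(1) AF len e(2)] by simp
  qed
  then show "infty_numrange A \<subseteq> infty_numrange (op_tuple_add A F)"
    "infty_numrange A \<subseteq> rank_k_numrange k (op_tuple_add A F)" by blast+
qed

text \<open>Allows a perturbation to be undone, which reverses the inclusion between the
  infinite-rank ranges.\<close>

lemma uminus_sa_finite_rank_tuples:
  assumes "F \<in> sa_finite_rank_tuples m"
  shows "map (\<lambda>T x. - T x) F \<in> sa_finite_rank_tuples m"
proof -
  have "self_adjoint (\<lambda>x. - (F ! j) x)" "finite_rank (\<lambda>x. - (F ! j) x)" if "j < m" for j
  proof -
    show sa: "self_adjoint (\<lambda>x. - (F ! j) x)"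
      using assms that by (simp add: sa_finite_rank_tuples_def self_adjoint_minus)
    have "finite_rank (F ! j)" using assms that by (simp add: sa_finite_rank_tuples_def)
    then obtain S where "finite S" "range (F ! j) \<subseteq> cvs.span S"
      unfolding finite_rank_def cspan_eq_span by blast
    then have "range (\<lambda>x. - (F ! j) x) \<subseteq> cvs.span S" by (auto intro!: cvs.span_neg)
    then show "finite_rank (\<lambda>x. - (F ! j) x)"
      using \<open>finite S\<close> self_adjoint_bounded[OF sa] by (auto simp: finite_rank_def cspan_eq_span)
  qed
  then show ?thesis using assms by (simp add: sa_finite_rank_tuples_def)
qed

lemma op_tuple_add_uminus_cancel:
  "F \<in> sa_finite_rank_tuples (length A) \<Longrightarrow> op_tuple_add (op_tuple_add A F) (map (\<lambda>T x. - T x) F) = A"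
  by (rule nth_equalityI) (simp_all add: op_tuple_add_def sa_finite_rank_tuples_def)

text \<open>The perturbation replaces \<open>A\<^sub>j\<close> by \<open>Q A\<^sub>j Q + c\<^sub>j B\<close>, where \<open>B\<close> projects onto the span of \<open>S\<close>,
  \<open>Q = 1 - B\<close>, and \<open>c\<close> is a scalar compression of \<open>A\<close> of large rank on the range of \<open>Q\<close>. In a unit
  vector representing \<open>a\<close> for the perturbed tuple, the component along \<open>S\<close> can then be
  traded for a vector of the same length orthogonal to \<open>S\<close>.\<close>

lemma joint_value_perp:
  fixes A :: "('a::complex_inner \<Rightarrow> 'a) list"
  assumes inf: "infinite_dimensional TYPE('a)" and A: "\<forall>j<length A. self_adjoint (A ! j)"
    and n: "n \<ge> 1" and S: "finite S"
    and a: "\<And>F. F \<in> sa_finite_rank_tuples (length A) \<Longrightarrow> a \<in> rank_k_numrange n (op_tuple_add A F)"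
  obtains x where "x \<in> perp S" "cinner x x = 1"
    "\<And>j. j < length A \<Longrightarrow> cinner x ((A ! j) x) = complex_of_real (a ! j)"
proof -
  define m where "m = length A"
  obtain E where E: "finite E" "orthonormal_on E (\<lambda>v. v)" "S \<subseteq> cvs.span E"
    using Gram_Schmidt[OF S] .
  define B where "B = proj_on E (\<lambda>v. v)"
  define Q where "Q x = x + - B x" for x
  have B: "self_adjoint B" "B (B x) = B x" for x
    using orth_proj_proj_on[OF E(2,1)] by (auto simp: B_def orth_proj_def)
  have Q: "self_adjoint Q"
    unfolding Q_def by (intro self_adjoint_plus self_adjoint_minus self_adjoint_id B)
  have bB: "bounded_op B" and bQ: "bounded_op Q" using B Q by (simp_all add: self_adjoint_bounded)
  have BS: "B s = s" if "s \<in> S" for s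
    using proj_on_id[OF E(2,1), of s] E(3) that by (auto simp: B_def)
  have B_range: "B x \<in> cvs.span E" for x
    using proj_on_in_span[of E "\<lambda>v. v" x] by (simp add: B_def)
  \<comment> \<open>The dimension \<open>m + 2\<close> exceeds the at most \<open>m + 1\<close>
    orthogonality conditions imposed on \<open>y\<close> later on.\<close>
  obtain f c' where f: "orthonormal_on {..<m + 2} f" "f ` {..<m + 2} \<subseteq> perp S"
    and c': "\<And>T i k. T \<in> set A \<Longrightarrow> i < m + 2 \<Longrightarrow> k < m + 2 \<Longrightarrow>
      cinner (f i) (T (f k)) = complex_of_real (c' T) * of_bool (i = k)"
    using exists_scalar_compression[OF inf S finite_set[of A]] A by (metis in_set_conv_nth)
  define c where "c = map c' A"
  have scalar: "scalar_on {..<m + 2} f A c"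
    by (auto simp: scalar_on_def c_def c')
  \<comment> \<open>Subtracting \<open>T\<close> makes the perturbed operator exactly
    \<open>Q T Q + c' T B\<close>.\<close>
  define F where "F = map (\<lambda>T x. (Q (T (Q x)) + scaleC (complex_of_real (c' T)) (B x)) + - T x) A"
  have F: "F \<in> sa_finite_rank_tuples (length A)"
  proof -
    have "self_adjoint (F ! j)" "finite_rank (F ! j)" if j: "j < length A" for j
    proof -
      let ?T = "A ! j"
      have T: "self_adjoint ?T" using A j by blast
      then have bT: "bounded_op ?T" by (rule self_adjoint_bounded)
      have Fj: "F ! j = (\<lambda>x. (Q (?T (Q x)) + scaleC (complex_of_real (c' ?T)) (B x)) + - ?T x)"
        using j by (simp add: F_def)
      show sa: "self_adjoint (F ! j)"
        unfolding Fj by (rule self_adjoint_plus[OF self_adjoint_plus[OF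
              self_adjoint_sandwich[OF T Q] self_adjoint_scale[OF B(1)]] self_adjoint_minus[OF T]])
      have "(F ! j) x \<in> cvs.span (E \<union> ?T ` E)" for x
      proof -
        have "(F ! j) x = scaleC (complex_of_real (c' ?T)) (B x) - B (?T (Q x)) - ?T (B x)"
          unfolding Fj Q_def by (simp add: bounded_op_simps[OF bT] bounded_op_simps[OF bB])
        moreover have "B y \<in> cvs.span (E \<union> ?T ` E)" for y
          using B_range[of y] cvs.span_mono[of E "E \<union> ?T ` E"] by blast
        moreover have "?T (B x) \<in> cvs.span (E \<union> ?T ` E)"
          unfolding B_def proj_on_def bounded_op_sum[OF bT] bounded_op_scaleC[OF bT]
          by (intro cvs.span_sum cvs.span_scale cvs.span_base) simp
        ultimately show ?thesis by (simp add: cvs.span_diff cvs.span_scale)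
      qed
      then show "finite_rank (F ! j)"
        using E(1) self_adjoint_bounded[OF sa] unfolding finite_rank_def cspan_eq_span
        by (intro conjI exI[of _ "E \<union> ?T ` E"]) auto
    qed
    then show ?thesis by (simp add: sa_finite_rank_tuples_def F_def)
  qed
  obtain z where z: "cinner z z = 1"
    "\<And>j. j < length A \<Longrightarrow> cinner z ((op_tuple_add A F ! j) z) = complex_of_real (a ! j)"
    using rank_k_numrange_unit_vector[OF a[OF F] n] length_op_tuple_add[OF F] by metis
  define u where "u = Q z"
  \<comment> \<open>The length of the component of \<open>z\<close> to be traded; its square is the
    weight of \<open>c\<close> in the convex combination.\<close>
  define r where "r = cnorm (B z)"
  have zB: "cinner z (B z) = complex_of_real (r\<^sup>2)"
    using self_adjointD[OF B(1), of z "B z"] cinner_self[of "B z"] by (simp add: r_def B(2))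
  then have Bz: "cinner (B z) z = complex_of_real (r\<^sup>2)" by (simp add: self_adjointD[OF B(1)])
  have BzB: "cinner (B z) (B z) = complex_of_real (r\<^sup>2)" by (simp add: r_def cinner_self)
  have uu: "cinner u u + complex_of_real (r\<^sup>2) = 1"
    using z(1) zB Bz BzB by (simp add: u_def Q_def cinner_simps)
  have uA: "cinner u ((A ! j) u) + complex_of_real (c ! j) * complex_of_real (r\<^sup>2) = complex_of_real (a ! j)"
    if j: "j < length A" for j
  proof -
    have "(op_tuple_add A F ! j) z = Q ((A ! j) u) + scaleC (complex_of_real (c ! j)) (B z)"
      using j unfolding nth_op_tuple_add[OF F j] by (simp add: F_def u_def c_def)
    then show ?thesis
      using z(2)[OF j] zB by (simp add: cinner_simps u_def self_adjointD[OF Q])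
  qed
  \<comment> \<open>Orthogonality to \<open>u\<close> and to each image of \<open>u\<close> removes
    all cross terms from the forms at \<open>u + r y\<close>.\<close>
  define R where "R = insert u ((\<lambda>T. T u) ` set A)"
  have "card R \<le> Suc (card ((\<lambda>T. T u) ` set A))" unfolding R_def by (rule card_insert_le_m1) simp_all
  also have "\<dots> \<le> Suc m"
    unfolding m_def using card_image_le[of "set A" "\<lambda>T. T u"] card_length[of A] by simp
  finally have "card R < card {..<m + 2}" by simp
  moreover have "finite R" by (simp add: R_def)
  ultimately obtain y where y: "y \<in> cvs.span (f ` {..<m + 2})" "y \<in> perp R" "cinner y y = 1"
    using unit_vector_perp_orthonormal[OF f(1)] by blast
  have yS: "y \<in> perp S"
    using y(1) cvs.span_minimal[OF f(2) subspace_perp] by blast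
  have Py: "proj_on {..<m + 2} f y = y" by (rule proj_on_id[OF f(1) _ y(1)]) simp
  \<comment> \<open>Any unit vector in the span of \<open>f\<close> has the values \<open>c\<close>,
    since the compression there is scalar.\<close>
  have yA: "cinner y ((A ! j) y) = complex_of_real (c ! j)" if j: "j < length A" for j
  proof -
    have "compresses (proj_on {..<m + 2} f) A c"
      using A by (intro compresses_proj_on f(1) scalar) (simp_all add: c_def self_adjoint_bounded)
    then have "proj_on {..<m + 2} f ((A ! j) (proj_on {..<m + 2} f y)) =
        scaleC (complex_of_real (c ! j)) (proj_on {..<m + 2} f y)"
      using j unfolding compresses_def by blast
    then have "cinner y (proj_on {..<m + 2} f ((A ! j) y)) = complex_of_real (c ! j)"
      unfolding Py by (simp add: cinner_simps y(3))
    then show ?thesis unfolding proj_on_adjoint[symmetric] Py .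
  qed
  \<comment> \<open>The component \<open>B z\<close> is replaced by a vector of the same length
    \<open>r\<close> that is orthogonal to \<open>S\<close> and contributes the same amount to each
    form.\<close>
  define x where "x = u + scaleC (complex_of_real r) y"
  have uy: "cinner u y = 0" "cinner y u = 0"
    using y(2) by (simp_all add: R_def perp_def cinner_eq_zero_commute[of y])
  have uS: "u \<in> perp S"
    using BS by (auto simp: perp_def u_def Q_def cinner_simps simp flip: self_adjointD[OF B(1)])
  show thesis
  proof (rule that[of x])
    show "x \<in> perp S"
      unfolding x_def using uS yS subspace_perp by (intro cvs.subspace_add cvs.subspace_scale)
    show "cinner x x = 1"
      using uu uy y(3) by (simp add: x_def cinner_simps power2_eq_square)
    show "cinner x ((A ! j) x) = complex_of_real (a ! j)" if j: "j < length A" for j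
    proof -
      have T: "self_adjoint (A ! j)" using A j by blast
      note bT = self_adjoint_bounded[OF T]
      have "cinner ((A ! j) u) y = 0" using y(2) j by (auto simp: R_def perp_def)
      then have "cinner u ((A ! j) y) = 0" "cinner y ((A ! j) u) = 0"
        by (simp_all add: self_adjointD[OF T] cinner_eq_zero_commute[of y])
      then have "cinner x ((A ! j) x) = cinner u ((A ! j) u) + complex_of_real (c ! j) * complex_of_real (r\<^sup>2)"
        using yA[OF j]
        by (simp add: x_def bounded_op_simps[OF bT] cinner_simps power2_eq_square)
      then show ?thesis using uA[OF j] by simp
    qed
  qed
qed

text \<open>\<open>joint_value_perp\<close> supplies the vectors for
  \<open>diagonal_sequence\<close>: the property \<open>val\<close> fixes the diagonal entries, the
  recursion removes the others.\<close>

lemma infty_numrangeI_perturbation: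
  fixes A F :: "('a::chilbert_space \<Rightarrow> 'a) list"
  assumes inf: "infinite_dimensional TYPE('a)" and A: "\<forall>j<length A. self_adjoint (A ! j)"
    and n: "n \<ge> 1"
    and a: "a \<in> (\<Inter>F\<in>sa_finite_rank_tuples (length A). rank_k_numrange n (op_tuple_add A F))"
    and F: "F \<in> sa_finite_rank_tuples (length A)"
  shows "a \<in> infty_numrange A"
proof -
  define val where "val x \<longleftrightarrow> (\<forall>j<length A. cinner x ((A ! j) x) = complex_of_real (a ! j))" for x
  \<comment> \<open>The member \<open>F\<close> of the index set is where the length of
    \<open>a\<close> is read off.\<close>
  have len: "length a = length A"
    using a F length_op_tuple_add[OF F] by (auto simp: rank_k_numrange_def)
  have "\<exists>x. val x \<and> x \<in> perp S \<and> cinner x x = 1" if "finite S" for S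
    using joint_value_perp[OF inf A n that, of a] a unfolding val_def by blast
  moreover have "self_adjoint T" if "T \<in> set A" for T
    using that A by (auto simp: in_set_conv_nth)
  ultimately obtain e :: "nat \<Rightarrow> 'a" where e: "orthonormal_on UNIV e" "\<And>i. val (e i)"
      "\<And>T i k. T \<in> set A \<Longrightarrow> i \<noteq> k \<Longrightarrow> cinner (e i) (T (e k)) = 0"
    using diagonal_sequence[of val "set A"] by (metis finite_set)
  have "scalar_on UNIV e A a"
    using e(2,3) by (auto simp: scalar_on_def val_def)
  then show ?thesis by (rule infty_numrangeI[OF e(1) A len])
qed

theorem theorem4p3:
  fixes A F0 :: "('a::chilbert_space \<Rightarrow> 'a) list" and n :: nat
  assumes "infinite_dimensional TYPE('a)"
    and "\<forall>j<length A. self_adjoint (A ! j)"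
    and "n \<ge> 1"
    and "F0 \<in> sa_finite_rank_tuples (length A)"
  shows "infty_numrange A = infty_numrange (op_tuple_add A F0)
    \<and> infty_numrange A =
        (\<Inter>F\<in>sa_finite_rank_tuples (length A). rank_k_numrange n (op_tuple_add A F))
    \<and> infty_numrange A =
        (\<Inter>k\<in>{1..}. \<Inter>F\<in>sa_finite_rank_tuples (length A). rank_k_numrange k (op_tuple_add A F))"
proof -
  note A = assms(2) and F0 = assms(4)
  \<comment> \<open>Apply the general inclusion to the perturbed tuple and the perturbation by the
    negatives of \<open>F0\<close>.\<close>
  have "infty_numrange (op_tuple_add A F0) \<subseteq> infty_numrange A"
    using infty_numrange_subset_perturbation(1)[OF self_adjoint_op_tuple_add[OF A F0],
        of "map (\<lambda>T x. - T x) F0"] uminus_sa_finite_rank_tuples[OF F0]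
    by (simp add: length_op_tuple_add[OF F0] op_tuple_add_uminus_cancel[OF F0])
  then have "infty_numrange A = infty_numrange (op_tuple_add A F0)"
    using infty_numrange_subset_perturbation(1)[OF A F0] by blast
  moreover have upper: "(\<Inter>F\<in>sa_finite_rank_tuples (length A). rank_k_numrange n (op_tuple_add A F))
      \<subseteq> infty_numrange A"
    using infty_numrangeI_perturbation[OF assms(1) A assms(3) _ F0] by blast
  moreover have lower: "infty_numrange A \<subseteq>
      (\<Inter>F\<in>sa_finite_rank_tuples (length A). rank_k_numrange k (op_tuple_add A F))" for k
    using infty_numrange_subset_perturbation(2)[OF A] by blast
  moreover have "infty_numrange A =
      (\<Inter>k\<in>{1..}. \<Inter>F\<in>sa_finite_rank_tuples (length A). rank_k_numrange k (op_tuple_add A F))"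
    (is "_ = (\<Inter>k\<in>{1..}. ?G k)")
  proof
    show "infty_numrange A \<subseteq> (\<Inter>k\<in>{1..}. ?G k)" using lower by (rule INT_greatest)
    \<comment> \<open>The given \<open>n\<close> is one of the ranks \<open>k\<close>, so the set
      for this single rank contains the full intersection.\<close>
    have "n \<in> {1..}" using assms(3) by simp
    then have "(\<Inter>k\<in>{1..}. ?G k) \<subseteq> ?G n" by (rule INT_lower)
    then show "(\<Inter>k\<in>{1..}. ?G k) \<subseteq> infty_numrange A" using upper by (rule order_trans)
  qed
  moreover have "infty_numrange A =
      (\<Inter>F\<in>sa_finite_rank_tuples (length A). rank_k_numrange n (op_tuple_add A F))"
    using lower upper by (rule equalityI)
  ultimately show ?thesis by blast
qed

end
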